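(* Let \(n\) be a nonnegative integer, let \(A\) and \(B\) be subsets of \(\{0,1,\ldots,n\}\) of equal size, and let \(A^\mathsf{c}\) and \(B^\mathsf{c}\) be their complements in \(\{0,1,\ldots,n\}\). Let \(\alpha\) and \(\beta\) be partitions with \(n\) parts (with parts equal to \(0\) permitted) such that \(\alpha_i \leq \beta_i\) for all \(i\). Suppose that for all \(a' \in A^\mathsf{c}\) and \(b' \in B^\mathsf{c}\), either: (i) \(a' - b' \leq 0\); or (ii) \(a' - b' > \beta_{b'+1} - \alpha_{a'}\); or (iii) for all \(i\) such that \(b'+1 \leq i \leq a'\), we have \(\alpha_{i} - \alpha_{a'} \leq a'-i\) and \(\beta_{b'+1} - \beta_i \leq i-b'-1\). Then the determinants \[ \det\Bigl( h_{b - a} (x_{\alpha_{a+1}+1}, x_{\alpha_{a+1}+2}, \ldots, x_{\beta_{b}}) \Bigr)_{a \in A, b \in B} \] and \[ \det\Bigl( e_{a' - b'} (x_{\alpha_{a'}+1}, x_{\alpha_{a'}+2}, \ldots, x_{\beta_{b'+1}}) \Bigr)_{a' \in A^\mathsf{c}, b' \in B^\mathsf{c}} \] are equal.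
   Context: Here \(h_i\) and \(e_i\) denote the complete homogeneous and elementary symmetric polynomials of degree \(i\), with the conventions \(e_0 = h_0 = 1\) and \(e_d = h_d = 0\) for \(d < 0\); symmetric polynomials of positive degree in an empty set of variables are \(0\). Finite subsets of \(\mathbb{Z}\) used to index matrix rows and columns are ordered from smallest to largest element. Where needed, \(\alpha_{n+1}\) is interpreted as \(\alpha_n\) and \(\beta_0\) as \(\beta_1\). *)

theory Defs
  imports "Jordan_Normal_Form.DL_Submatrix" "Jordan_Normal_Form.Determinant" "HOL-Library.Multiset"
begin

(* Symmetric polynomials in the variables x_i, i in S, where x takes values in an arbitrary
   commutative ring; taking the x_i to be the indeterminates of a polynomial ring over the
   integers gives the formal polynomials. The degree is an integer: for negative d the index
   set of the sum is empty, so that the value is 0. The finite set S may be empty. *)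

definition complete_sym :: "int \<Rightarrow> (nat \<Rightarrow> 'a::comm_ring_1) \<Rightarrow> nat set \<Rightarrow> 'a" where
  "complete_sym d x S =
     (\<Sum>M \<in> {M. set_mset M \<subseteq> S \<and> int (size M) = d}. \<Prod>i\<in>#M. x i)"

definition elementary_sym :: "int \<Rightarrow> (nat \<Rightarrow> 'a::comm_ring_1) \<Rightarrow> nat set \<Rightarrow> 'a" where
  "elementary_sym d x S = (\<Sum>T \<in> {T. T \<subseteq> S \<and> int (card T) = d}. \<Prod>i\<in>T. x i)"

(* The parts are lam 1, ..., lam n. The values at 0 and n + 1 are left arbitrary, so every
   convention for them is covered. *)

definition partition_with_parts :: "nat \<Rightarrow> (nat \<Rightarrow> nat) \<Rightarrow> bool" where
  "partition_with_parts n lam \<longleftrightarrow> antimono_on {1..n} lam"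

(* The matrix (f a b) with rows a in A and columns b in B, for A and B subsets of {0..n};
   submatrix keeps the rows and the columns in increasing order. *)

definition indexed_mat ::
  "nat \<Rightarrow> nat set \<Rightarrow> nat set \<Rightarrow> (nat \<Rightarrow> nat \<Rightarrow> 'a) \<Rightarrow> 'a mat" where
  "indexed_mat n A B f = submatrix (mat (n + 1) (n + 1) (\<lambda>(a, b). f a b)) A B"

end

theory Submission
  imports Defs
begin

text \<open>The unitriangular matrix \<open>H\<close> of all \<open>h\<^bsub>b-a\<^esub>(x\<^bsub>\<alpha>(a+1)+1\<^esub>, \<dots>, x\<^bsub>\<beta>(b)\<^esub>)\<close>
  with \<open>a, b \<in> {0..n}\<close> has an explicit inverse: up to the sign \<open>(-1)\<^bsup>b+c\<^esup>\<close>, its entry at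
  \<open>(b, c)\<close> is the generating function of the strictly decreasing sequences
  \<open>T\<^bsub>b+1\<^esub> > \<dots> > T\<^bsub>c\<^esub>\<close> with \<open>\<alpha> j < T\<^bsub>j\<^esub> \<le> \<beta> j\<close>. Under condition (iii) the bounds for
  \<open>j = c\<close> (below) and \<open>j = b+1\<close> (above) imply all others, so the generating function is an
  elementary symmetric polynomial; under (ii) both are zero. The two determinants are then
  complementary minors of \<open>H\<close> and its inverse, related by Jacobi's identity.\<close>

section \<open>Minors through \<open>pick\<close>: reindexing, and deletion of a row and a
  column\<close>

lemma pick_bij_betw:
  assumes "finite S"
  shows "bij_betw (pick S) {..<card S} S"
proof -
  have "inj_on (pick S) {..<card S}"
  proof (rule inj_onI)
    fix i j assume "i \<in> {..<card S}" "j \<in> {..<card S}" "pick S i = pick S j"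
    then show "i = j"
      using pick_mono_le[of i S j] pick_mono_le[of j S i] by (cases i j rule: linorder_cases) auto
  qed
  moreover have "pick S ` {..<card S} \<subseteq> S"
    using pick_in_set_le by auto
  ultimately show ?thesis
    using assms by (simp add: bij_betw_def card_image card_subset_eq)
qed

text \<open>\<open>pick S k\<close> is the element of \<open>S\<close> with exactly \<open>k\<close>
  smaller ones, a count that \<open>f\<close> preserves.\<close>

lemma pick_strict_mono_image:
  assumes "strict_mono_on S f" "k < card S"
  shows "pick (f ` S) k = f (pick S k)"
proof -
  have inj: "inj_on f S" using assms(1) strict_mono_on_imp_inj_on by blast
  have "pick S k \<in> S" using assms(2) pick_in_set_le by blast
  moreover from this have "{a \<in> f ` S. a < f (pick S k)} = f ` {a \<in> S. a < pick S k}"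
    using strict_mono_on_less[OF assms(1)] by auto
  moreover have "card (f ` {a \<in> S. a < pick S k}) = k"
    using card_image[OF inj_on_subset[OF inj, of "{a \<in> S. a < pick S k}"]] card_pick_le[OF assms(2)]
    by simp
  ultimately show ?thesis
    using pick_card_in_set[of "f (pick S k)" "f ` S"] by simp
qed

lemma pick_lessThan: "i < n \<Longrightarrow> pick {..<n} i = i"
proof -
  assume "i < n"
  moreover from this have "{a \<in> {..<n}. a < i} = {..<i}" by auto
  ultimately show ?thesis using pick_card_in_set[of i "{..<n}"] by simp
qed

lemma submatrix_eq:
  assumes "M \<in> carrier_mat m n" "I \<subseteq> {..<m}" "J \<subseteq> {..<n}"
  shows "submatrix M I J = mat (card I) (card J) (\<lambda>(i, j). M $$ (pick I i, pick J j))"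
proof -
  have "{i. i < m \<and> i \<in> I} = I" "{j. j < n \<and> j \<in> J} = J" using assms by auto
  then show ?thesis using assms(1) by (simp add: submatrix_def)
qed

lemma submatrix_mat:
  assumes "I \<subseteq> {..<m}" "J \<subseteq> {..<n}"
  shows "submatrix (mat m n (\<lambda>(i, j). f i j)) I J
    = mat (card I) (card J) (\<lambda>(i, j). f (pick I i) (pick J j))"
proof -
  have "pick I i < m" if "i < card I" for i using pick_in_set_le[OF that] assms(1) by auto
  moreover have "pick J j < n" if "j < card J" for j using pick_in_set_le[OF that] assms(2) by auto
  ultimately show ?thesis
    using submatrix_eq[OF _ assms, of "mat m n (\<lambda>(i, j). f i j)"] by (auto intro!: cong_mat)
qed

text \<open>\<open>insert_index c\<close> translates the indices after deletion of row
  \<open>c\<close> into the old ones. As \<open>c\<close> is the largest element of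
  \<open>C\<close>, the others lie below it and keep their numbers.\<close>

lemma lessThan_Suc_diff_eq_insert_index_image:
  assumes "c \<in> C" "C \<subseteq> {..c}" "c \<le> n"
  shows "{..<Suc n} - C = insert_index c ` ({..<n} - (C - {c}))"
proof (intro equalityI subsetI)
  fix i assume i: "i \<in> {..<Suc n} - C"
  show "i \<in> insert_index c ` ({..<n} - (C - {c}))"
  proof (cases "i < c")
    case True
    then have "insert_index c i = i" by (simp add: insert_index_def)
    then show ?thesis using i True assms by (intro image_eqI[of _ _ i]) auto
  next
    case False
    then have "c < i" using i assms(1) by (cases "i = c") auto
    then have "insert_index c (i - 1) = i" by (simp add: insert_index_def)
    moreover have "i - 1 \<in> {..<n} - (C - {c})" using \<open>c < i\<close> i assms(2) by auto
    ultimately show ?thesis by (metis image_eqI)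
  qed
next
  fix i assume "i \<in> insert_index c ` ({..<n} - (C - {c}))"
  then obtain j where "i = insert_index c j" "j < n" "j \<notin> C \<or> j = c" by auto
  then show "i \<in> {..<Suc n} - C"
    using assms by (auto simp: insert_index_def split: if_splits)
qed

lemma submatrix_mat_delete:
  assumes M: "M \<in> carrier_mat (Suc n) (Suc n)"
    and "C \<subseteq> {..c}" "c \<in> C" "c \<le> n" "D \<subseteq> {..d}" "d \<in> D" "d \<le> n"
  shows "submatrix (mat_delete M c d) ({..<n} - (C - {c})) ({..<n} - (D - {d}))
    = submatrix M ({..<Suc n} - C) ({..<Suc n} - D)"
proof -
  let ?C = "{..<n} - (C - {c})" and ?D = "{..<n} - (D - {d})"
  have mono: "strict_mono_on S (insert_index e)" for e S
    by (auto simp: monotone_on_def insert_index_def)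
  have C: "{..<Suc n} - C = insert_index c ` ?C" and D: "{..<Suc n} - D = insert_index d ` ?D"
    using assms by (simp_all add: lessThan_Suc_diff_eq_insert_index_image)
  have card: "card (insert_index e ` S) = card S" for e S
    using strict_mono_on_imp_inj_on[OF mono] by (simp add: card_image)
  have "pick ?C i < n" if "i < card ?C" for i using pick_in_set_le[OF that] by auto
  moreover have "pick ?D i < n" if "i < card ?D" for i using pick_in_set_le[OF that] by auto
  ultimately show ?thesis
    using mat_delete_carrier[OF M, of c d] assms
    by (subst submatrix_eq[of _ n n], simp, blast, blast, subst submatrix_eq[OF M], blast, blast)
       (auto intro!: cong_mat simp: C D card pick_strict_mono_image[OF mono] mat_delete_index[OF M])
qed

section \<open>Determinants: unit columns, complementary minors, signs\<close>

lemma pick_remove_max: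
  assumes "c \<in> C" "C \<subseteq> {..c}"
  shows "k < card (C - {c}) \<Longrightarrow> pick (C - {c}) k = pick C k"
    and "pick C (card (C - {c})) = c"
proof -
  have eq: "{a. a < c \<and> a \<in> C} = C - {c}" "{a \<in> C. a < c} = C - {c}" using assms by auto
  show "pick (C - {c}) k = pick C k" if "k < card (C - {c})"
    using pick_reduce_set[of k c C] that by (simp add: eq)
  show "pick C (card (C - {c})) = c"
    using pick_card_in_set[OF assms(1)] by (simp add: eq)
qed

lemma det_unit_columns:
  fixes Y :: "'a::comm_ring_1 mat"
  assumes "Y \<in> carrier_mat N N" "C \<subseteq> {..<N}" "D \<subseteq> {..<N}" "card C = card D"
    and "\<And>i k. k < card C \<Longrightarrow> i < N \<Longrightarrow> Y $$ (i, pick D k) = (if i = pick C k then 1 else 0)"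
  shows "det Y = (-1) ^ (\<Sum>C + \<Sum>D) * det (submatrix Y ({..<N} - C) ({..<N} - D))"
  using assms
proof (induction "card C" arbitrary: N Y C D)
  case 0
  then have "C = {}" "D = {}" using finite_subset by fastforce+
  moreover have "submatrix Y {..<N} {..<N} = Y"
    using 0(2) by (subst submatrix_eq[of _ N N]) (auto intro!: eq_matI simp: pick_lessThan)
  ultimately show ?case by simp
next
  case (Suc k)
  have fin: "finite C" "finite D" using finite_subset[OF Suc.prems(2)] finite_subset[OF Suc.prems(3)] by simp_all
  have ne: "C \<noteq> {}" "D \<noteq> {}" using Suc.hyps(2) Suc.prems(4) by auto
  define c d where "c = Max C" and "d = Max D"
  have c: "c \<in> C" "C \<subseteq> {..c}" and d: "d \<in> D" "D \<subseteq> {..d}"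
    using fin ne by (auto simp: c_def d_def)
  obtain n where N: "N = Suc n" using Suc.prems(2) c(1) by (cases N) auto
  have le: "c \<le> n" "d \<le> n" using c(1) d(1) Suc.prems N by auto
  let ?C = "C - {c}" and ?D = "D - {d}"
  have card: "card ?C = k" "card ?D = k" using Suc.hyps(2) Suc.prems(4) c(1) d(1) by auto
  have Y: "Y \<in> carrier_mat (Suc n) (Suc n)" using Suc.prems(1) N by simp
  have Yd: "Y $$ (i, d) = (if i = c then 1 else 0)" if "i < N" for i
    using Suc.prems(5)[of k i] that Suc.hyps(2) pick_remove_max(2)[OF c] pick_remove_max(2)[OF d] card
    by simp
  have "det Y = (\<Sum>i<N. Y $$ (i, d) * cofactor Y i d)"
    using laplace_expansion_column[OF Suc.prems(1)] le N by simp
  also have "\<dots> = (\<Sum>i<N. if i = c then cofactor Y i d else 0)"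
    by (rule sum.cong) (simp_all add: Yd)
  also have "\<dots> = (-1) ^ (c + d) * det (mat_delete Y c d)"
    using le N by (simp add: cofactor_def)
  also have "det (mat_delete Y c d)
      = (-1) ^ (\<Sum>?C + \<Sum>?D) * det (submatrix (mat_delete Y c d) ({..<n} - ?C) ({..<n} - ?D))"
  proof (rule Suc.hyps(1))
    show "k = card ?C" "card ?C = card ?D" using card by simp_all
    show "mat_delete Y c d \<in> carrier_mat n n" using mat_delete_carrier[OF Y] by simp
    show "?C \<subseteq> {..<n}" "?D \<subseteq> {..<n}" using c d le by fastforce+
    fix i j assume j: "j < card ?C" and i: "i < n"
    have pC: "pick C j < c" and pD: "pick D j < d"
      using pick_in_set_le[OF j] pick_in_set_le[of j ?D] j card c d
        pick_remove_max(1)[OF c, of j] pick_remove_max(1)[OF d, of j] by fastforce+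
    have "mat_delete Y c d $$ (i, pick ?D j) = Y $$ (insert_index c i, pick D j)"
      using mat_delete_index[OF Y, of c d i "pick D j"] le i j pD card pick_remove_max(1)[OF d, of j]
      by (simp add: insert_index_def)
    also have "\<dots> = (if insert_index c i = pick C j then 1 else 0)"
      using Suc.prems(5)[of j "insert_index c i"] i j card Suc.hyps(2) N by (simp add: insert_index_def)
    also have "insert_index c i = pick C j \<longleftrightarrow> i = pick ?C j"
      using pC pick_remove_max(1)[OF c j] by (auto simp: insert_index_def)
    finally show "mat_delete Y c d $$ (i, pick ?D j) = (if i = pick ?C j then 1 else 0)" .
  qed
  also have "submatrix (mat_delete Y c d) ({..<n} - ?C) ({..<n} - ?D)
      = submatrix Y ({..<N} - C) ({..<N} - D)"
    unfolding N using submatrix_mat_delete[OF Y] c d le by blast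
  finally show ?case
    using sum.remove[OF fin(1) c(1), of "\<lambda>x. x"] sum.remove[OF fin(2) d(1), of "\<lambda>x. x"]
    by (simp add: power_add mult_ac)
qed

text \<open>Jacobi's identity. The matrix \<open>X\<close> in the proof has unit columns at
  \<open>B\<close> and columns of \<open>G\<close> elsewhere, so that both \<open>X\<close> and \<open>H * X\<close> have many unit columns.\<close>

lemma det_submatrix_complementary:
  fixes H G :: "'a::comm_ring_1 mat"
  assumes H: "H \<in> carrier_mat N N" and G: "G \<in> carrier_mat N N" and HG: "H * G = 1\<^sub>m N"
    and A: "A \<subseteq> {..<N}" and B: "B \<subseteq> {..<N}" and card: "card A = card B"
  shows "det H * det (submatrix G ({..<N} - B) ({..<N} - A))
    = (-1) ^ (\<Sum>({..<N} - A) + \<Sum>({..<N} - B)) * det (submatrix H A B)"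
proof -
  let ?C = "{..<N} - A" and ?D = "{..<N} - B"
  \<comment> \<open>The column at the \<open>k\<close>-th element of \<open>?D\<close> is the column
    of \<open>G\<close> at the \<open>k\<close>-th element of \<open>?C\<close>:
    \<open>card {a\<in>?D. a < j}\<close> is the rank of \<open>j\<close> in
    \<open>?D\<close>.\<close>
  define X where "X = mat N N (\<lambda>(i, j). if j \<in> ?D then G $$ (i, pick ?C (card {a\<in>?D. a < j}))
    else if i = j then 1 else 0)"
  have X: "X \<in> carrier_mat N N" by (simp add: X_def)
  have cc: "card ?C = card ?D"
    using A B card finite_subset[OF A] finite_subset[OF B] by (simp add: card_Diff_subset)
  have pC: "pick ?C k < N" if "k < card ?C" for k using pick_in_set_le[OF that] by auto
  have pD: "pick ?D k < N" "pick ?D k \<in> ?D" if "k < card ?D" for k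
    using pick_in_set_le[OF that] by auto
  have XD: "X $$ (i, pick ?D k) = G $$ (i, pick ?C k)" if "k < card ?D" "i < N" for i k
    using that pD[OF that(1)] card_pick_le[OF that(1)] by (simp add: X_def)
  have compl: "{..<N} - ?C = A" using A by auto
  \<comment> \<open>The unit columns of \<open>X\<close> have their 1 on the diagonal, so the
    exponent of the sign is even.\<close>
  have "det X = (-1) ^ (\<Sum>B + \<Sum>B) * det (submatrix X ?D ?D)"
  proof (rule det_unit_columns[OF X B B refl])
    fix i k assume "k < card B" "i < N"
    then show "X $$ (i, pick B k) = (if i = pick B k then 1 else 0)"
      using pick_in_set_le[of k B] B by (auto simp: X_def)
  qed
  also have "submatrix X ?D ?D = submatrix G ?D ?C"
    using submatrix_eq[OF X, of ?D ?D] submatrix_eq[OF G, of ?D ?C]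
    by (auto intro!: cong_mat simp: cc XD pD(1))
  finally have detX: "det X = det (submatrix G ?D ?C)"
    by simp
  have Y: "H * X \<in> carrier_mat N N" using H X by simp
  \<comment> \<open>The columns of \<open>H * X\<close> at \<open>?D\<close> are columns of
    \<open>H * G\<close>, hence unit columns; those at \<open>B\<close> are columns of
    \<open>H\<close>.\<close>
  have "det (H * X) = (-1) ^ (\<Sum>?C + \<Sum>?D) * det (submatrix (H * X) ({..<N} - ?C) ({..<N} - ?D))"
  proof (rule det_unit_columns[OF Y _ _ cc])
    fix i k assume k: "k < card ?C" and i: "i < N"
    have "(H * X) $$ (i, pick ?D k) = (\<Sum>l\<in>{0..<N}. H $$ (i, l) * X $$ (l, pick ?D k))"
      using H X i k cc pD by (simp add: scalar_prod_def)
    also have "\<dots> = (\<Sum>l\<in>{0..<N}. H $$ (i, l) * G $$ (l, pick ?C k))"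
      using k cc by (intro sum.cong) (simp_all add: XD)
    also have "\<dots> = (H * G) $$ (i, pick ?C k)"
      using H G i pC[OF k] by (simp add: scalar_prod_def)
    finally show "(H * X) $$ (i, pick ?D k) = (if i = pick ?C k then 1 else 0)"
      using i pC[OF k] by (simp add: HG)
  qed auto
  also have "submatrix (H * X) ({..<N} - ?C) ({..<N} - ?D) = submatrix H A B"
  proof -
    have "(H * X) $$ (i, j) = H $$ (i, j)" if "i < N" "j \<in> B" for i j
    proof -
      have "j < N" using that B by auto
      then have "(H * X) $$ (i, j) = (\<Sum>l\<in>{0..<N}. H $$ (i, l) * X $$ (l, j))"
        using H X that by (simp add: scalar_prod_def)
      also have "\<dots> = (\<Sum>l\<in>{0..<N}. if l = j then H $$ (i, l) else 0)"
        using that \<open>j < N\<close> by (intro sum.cong) (auto simp: X_def)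
      also have "\<dots> = H $$ (i, j)" using \<open>j < N\<close> by simp
      finally show ?thesis .
    qed
    moreover have "pick A i < N" if "i < card A" for i using pick_in_set_le[OF that] A by auto
    moreover have "{..<N} - ?D = B" using B by auto
    ultimately show ?thesis
      unfolding compl submatrix_eq[OF H A B] using submatrix_eq[OF Y A B]
      by (auto intro!: cong_mat simp: pick_in_set_le)
  qed
  finally show ?thesis using det_mult[OF H X] detX by simp
qed

text \<open>Every term of the Leibniz formula takes one entry from each row and each column, so it
  carries each factor once.\<close>

lemma det_scale_rows_cols:
  "det (mat m m (\<lambda>(i, j). s i * t j * f i j))
    = (\<Prod>i<m. s i) * (\<Prod>j<m. t j) * det (mat m m (\<lambda>(i, j). f i j :: 'a::comm_ring_1))"
proof -
  have "(\<Prod>i = 0..<m. s i * t (p i) * f i (p i))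
      = (\<Prod>i<m. s i) * (\<Prod>j<m. t j) * (\<Prod>i = 0..<m. f i (p i))" if "p permutes {0..<m}" for p
    using prod.permute[OF that, of t] by (simp add: prod.distrib lessThan_atLeast0 comp_def)
  then show ?thesis
    by (auto simp: det_def sum_distrib_left permutes_in_image mult_ac intro!: sum.cong)
qed

text \<open>The sign is a row factor \<open>(-1) ^ i\<close> times a column factor
  \<open>(-1) ^ j\<close>.\<close>

lemma det_submatrix_checkerboard:
  fixes f :: "nat \<Rightarrow> nat \<Rightarrow> 'a::comm_ring_1"
  assumes "C \<subseteq> {..<N}" "D \<subseteq> {..<N}" "card C = card D"
  shows "det (submatrix (mat N N (\<lambda>(i, j). (-1) ^ (i + j) * f i j)) C D)
    = (-1) ^ (\<Sum>C + \<Sum>D) * det (submatrix (mat N N (\<lambda>(i, j). f i j)) C D)"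
proof -
  have sum: "(\<Sum>i<card S. pick S i) = \<Sum>S" if "S \<subseteq> {..<N}" for S
    using sum.reindex_bij_betw[OF pick_bij_betw, of S "\<lambda>x. x"] that finite_subset by blast
  have "(\<Prod>i<card D. (-1) ^ pick C i) = (-1 :: 'a) ^ \<Sum>C"
    using sum[OF assms(1)] assms(3) by (simp flip: power_sum)
  moreover have "(\<Prod>i<card D. (-1) ^ pick D i) = (-1 :: 'a) ^ \<Sum>D"
    using sum[OF assms(2)] by (simp flip: power_sum)
  ultimately show ?thesis
    using assms by (simp add: submatrix_mat det_scale_rows_cols power_add)
qed

section \<open>Recursions for complete and elementary symmetric polynomials\<close>

lemma complete_sym_neg: "d < 0 \<Longrightarrow> complete_sym d x S = 0"
  by (simp add: complete_sym_def)

lemma complete_sym_0 [simp]: "complete_sym 0 x S = 1"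
proof -
  have "{M. set_mset M \<subseteq> S \<and> int (size M) = 0} = {{#}}" by auto
  then show ?thesis by (simp add: complete_sym_def)
qed

lemma complete_sym_empty:
  assumes "d \<noteq> 0"
  shows "complete_sym d x {} = 0"
proof -
  have "{M. set_mset M \<subseteq> {} \<and> int (size M) = d} = {}" using assms by auto
  then show ?thesis unfolding complete_sym_def by (metis sum.empty)
qed

lemma finite_msets_of_size:
  assumes "finite S"
  shows "finite {M. set_mset M \<subseteq> S \<and> int (size M) = d}"
proof -
  have "{M. set_mset M \<subseteq> S \<and> int (size M) = d} \<subseteq> mset ` {xs. set xs \<subseteq> S \<and> length xs = nat d}"
  proof
    fix M assume "M \<in> {M. set_mset M \<subseteq> S \<and> int (size M) = d}"
    moreover obtain xs where "mset xs = M" using ex_mset by blast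
    ultimately show "M \<in> mset ` {xs. set xs \<subseteq> S \<and> length xs = nat d}" by force
  qed
  then show ?thesis using finite_lists_length_eq[OF assms] finite_surj by blast
qed

text \<open>Splits by whether \<open>u\<close> occurs. Removing one copy of \<open>u\<close> may
  leave others, so the last factor still involves \<open>u\<close>.\<close>

lemma complete_sym_insert:
  assumes "finite S" "u \<notin> S"
  shows "complete_sym d x (insert u S)
    = complete_sym d x S + x u * complete_sym (d - 1) x (insert u S)"
proof -
  let ?M = "\<lambda>d S. {M. set_mset M \<subseteq> S \<and> int (size M) = d}"
  have split: "?M d (insert u S) = ?M d S \<union> add_mset u ` ?M (d - 1) (insert u S)"
  proof (intro equalityI subsetI)
    fix M assume M: "M \<in> ?M d (insert u S)"
    show "M \<in> ?M d S \<union> add_mset u ` ?M (d - 1) (insert u S)"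
    proof (cases "u \<in># M")
      case True
      then obtain N where "M = add_mset u N" by (meson mset_add)
      with M show ?thesis by auto
    qed (use M in auto)
  qed auto
  have "u \<notin># M" if "M \<in> ?M d S" for M
    using that assms(2) by blast
  then have disj: "?M d S \<inter> add_mset u ` ?M (d - 1) (insert u S) = {}"
    by (metis (no_types, lifting) disjoint_iff imageE union_single_eq_member)
  have "complete_sym d x (insert u S)
      = complete_sym d x S + (\<Sum>M\<in>add_mset u ` ?M (d - 1) (insert u S). \<Prod>i\<in>#M. x i)"
    unfolding complete_sym_def[of d x "insert u S"] split
    by (subst sum.union_disjoint)
       (simp_all only: finite_msets_of_size finite_imageI finite_insert assms disj complete_sym_def)
  also have "(\<Sum>M\<in>add_mset u ` ?M (d - 1) (insert u S). \<Prod>i\<in>#M. x i)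
      = x u * complete_sym (d - 1) x (insert u S)"
    by (subst sum.reindex) (simp_all add: inj_on_def complete_sym_def sum_distrib_left)
  finally show ?thesis .
qed

lemma elementary_sym_neg: "d < 0 \<Longrightarrow> elementary_sym d x S = 0"
  by (simp add: elementary_sym_def)

lemma elementary_sym_0:
  assumes "finite S"
  shows "elementary_sym 0 x S = 1"
proof -
  have "{T. T \<subseteq> S \<and> int (card T) = 0} = {{}}"
    using assms finite_subset by fastforce
  then show ?thesis by (simp add: elementary_sym_def)
qed

lemma elementary_sym_eq_0:
  assumes "finite S" "int (card S) < d"
  shows "elementary_sym d x S = 0"
proof -
  have "{T. T \<subseteq> S \<and> int (card T) = d} = {}"
    using assms(2) by (auto dest: card_mono[OF assms(1)])
  then show ?thesis unfolding elementary_sym_def by (metis sum.empty)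
qed

text \<open>Splits by whether \<open>u\<close> occurs; a set loses \<open>u\<close> completely when
  it is removed.\<close>

lemma elementary_sym_insert:
  assumes "finite S" "u \<notin> S"
  shows "elementary_sym d x (insert u S)
    = elementary_sym d x S + x u * elementary_sym (d - 1) x S"
proof -
  let ?P = "\<lambda>d. {T. T \<subseteq> S \<and> int (card T) = d}"
  have fin: "finite T" if "T \<subseteq> S" for T using that assms finite_subset by blast
  have split: "{T. T \<subseteq> insert u S \<and> int (card T) = d} = ?P d \<union> insert u ` ?P (d - 1)"
  proof (intro equalityI subsetI)
    fix T assume T: "T \<in> {T. T \<subseteq> insert u S \<and> int (card T) = d}"
    show "T \<in> ?P d \<union> insert u ` ?P (d - 1)"
    proof (cases "u \<in> T")
      case True
      then have "T = insert u (T - {u})" by auto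
      moreover have "T - {u} \<in> ?P (d - 1)"
        using T True fin[of "T - {u}"] card_Suc_Diff1[of T u] finite_subset[of T "insert u S"] assms
        by auto
      ultimately show ?thesis by blast
    qed (use T in auto)
  next
    fix T assume "T \<in> ?P d \<union> insert u ` ?P (d - 1)"
    then show "T \<in> {T. T \<subseteq> insert u S \<and> int (card T) = d}"
    proof
      assume "T \<in> insert u ` ?P (d - 1)"
      then obtain R where R: "T = insert u R" "R \<subseteq> S" "int (card R) = d - 1" by auto
      then have "card T = Suc (card R)"
        using assms(2) fin[of R] by (simp add: card_insert_if) blast
      with R show ?thesis by auto
    qed auto
  qed
  have "inj_on (insert u) (?P (d - 1))"
    using assms(2) by (intro inj_onI) (metis (mono_tags, lifting) insert_ident mem_Collect_eq subset_eq)
  moreover have "(\<Prod>i\<in>insert u T. x i) = x u * prod x T" if "T \<subseteq> S" for T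
    using assms(2) fin[OF that] that by (subst prod.insert) auto
  moreover have "finite (?P d)" "finite (insert u ` ?P (d - 1))" "?P d \<inter> insert u ` ?P (d - 1) = {}"
    using assms by (auto simp: finite_subset[OF _ finite_Pow_iff[THEN iffD2, OF assms(1)]])
  ultimately show ?thesis
    unfolding elementary_sym_def split
    by (subst sum.union_disjoint) (auto simp: sum.reindex sum_distrib_left)
qed

text \<open>Multisets with an element above \<open>t\<close> are sorted by their maximum
  \<open>m\<close>, of which one copy is removed. The lower limit \<open>max l t + 1\<close> allows
  for \<open>t < l\<close>.\<close>

lemma complete_sym_split_max:
  assumes "t \<le> u" "d \<noteq> 0"
  shows "complete_sym d x {l+1..u}
    = complete_sym d x {l+1..t} + (\<Sum>m\<in>{max l t + 1..u}. x m * complete_sym (d - 1) x {l+1..m})"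
  using assms(1)
proof (induction u rule: dec_induct)
  case base
  then show ?case by simp
next
  case (step u)
  show ?case
  proof (cases "l \<le> u")
    case True
    then have "{l+1..Suc u} = insert (Suc u) {l+1..u}"
      "{max l t + 1..Suc u} = insert (Suc u) {max l t + 1..u}"
      using step.hyps by auto
    then show ?thesis
      using step.IH complete_sym_insert[of "{l+1..u}" "Suc u" d x]
      by (simp add: algebra_simps)
  next
    case False
    then have "{l+1..Suc u} = {}" "{l+1..t} = {}" "{max l t + 1..Suc u} = {}"
      using step.hyps by auto
    then show ?thesis by (simp only: complete_sym_empty[OF assms(2)]) simp
  qed
qed

text \<open>Sorts the subsets by their largest element \<open>t\<close>; the other elements lie
  below \<open>t\<close>.\<close>

lemma elementary_sym_split_max:
  assumes "d \<noteq> 0"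
  shows "elementary_sym d x {l+1..<m}
    = (\<Sum>t\<in>{l+1..<m}. x t * elementary_sym (d - 1) x {l+1..<t})"
proof (induction m)
  case 0
  then show ?case
    using assms elementary_sym_eq_0[of "{}" d x] elementary_sym_neg[of d x "{}"] 
    by (cases "d < 0") auto
next
  case (Suc m)
  show ?case
  proof (cases "l < m")
    case True
    then have "{l+1..<Suc m} = insert m {l+1..<m}" by auto
    then show ?thesis
      using Suc elementary_sym_insert[of "{l+1..<m}" m d x] by (simp add: algebra_simps)
  next
    case False
    then have "{l+1..<Suc m} = {}" "{l+1..<m} = {}" by auto
    then show ?thesis using Suc by (simp only:)
  qed
qed

section \<open>Column fillings with separate bounds for each entry\<close>

text \<open>Sum over the fillings \<open>T\<^sub>i\<^sub>+\<^sub>1 > \<dots> > T\<^sub>i\<^sub>+\<^sub>k\<close> with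
  \<open>\<alpha> j < T\<^sub>j \<le> \<beta> j\<close> and \<open>T\<^sub>i\<^sub>+\<^sub>1 < m\<close>: a flagged Schur polynomial of column shape.\<close>

fun flagged_column ::
  "(nat \<Rightarrow> nat) \<Rightarrow> (nat \<Rightarrow> nat) \<Rightarrow> (nat \<Rightarrow> 'a::comm_ring_1) \<Rightarrow> nat \<Rightarrow> nat \<Rightarrow> nat \<Rightarrow> 'a" where
  "flagged_column \<alpha> \<beta> x 0 i m = 1"
| "flagged_column \<alpha> \<beta> x (Suc k) i m =
     (\<Sum>t\<in>{t. \<alpha> (i+1) < t \<and> t \<le> \<beta> (i+1) \<and> t < m}. x t * flagged_column \<alpha> \<beta> x k (i+1) t)"

text \<open>The last entry exceeds \<open>l\<close>, so strict decrease forces the first to be at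
  least \<open>l + k\<close>, against the cutoff \<open>m\<close>.\<close>

lemma flagged_column_eq_0:
  assumes "0 < k" "m \<le> l + k" "\<And>j. i < j \<Longrightarrow> j \<le> i + k \<Longrightarrow> l \<le> \<alpha> j"
  shows "flagged_column \<alpha> \<beta> x k i m = 0"
  using assms
proof (induction k arbitrary: i m)
  case (Suc k)
  have "flagged_column \<alpha> \<beta> x k (i+1) t = 0" if "\<alpha> (i+1) < t" "t < m" for t
  proof (rule Suc.IH)
    \<comment> \<open>For \<open>k = 0\<close> one would have
      \<open>l < t < m \<le> l + 1\<close>.\<close>
    have "l \<le> \<alpha> (i+1)" using Suc.prems(3) by simp
    then show "0 < k" using that Suc.prems(2) by (cases k) auto
  qed (use that Suc.prems in auto)
  then show ?case by simp
qed simp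

text \<open>A strictly decreasing sequence above \<open>l\<close> and below \<open>m\<close>
  satisfies \<open>l + (i + k - j) < T\<^sub>j \<le> m - (j - i)\<close>, which implies the bounds
  by \<open>\<alpha> j\<close> and \<open>\<beta> j\<close>. So the fillings are the
  \<open>k\<close>-subsets of \<open>{l+1..<m}\<close>.\<close>

lemma flagged_column_eq_elementary_sym:
  assumes "\<And>j. i < j \<Longrightarrow> j \<le> i + k \<Longrightarrow> l \<le> \<alpha> j \<and> \<alpha> j + j \<le> l + (i + k) \<and> m + i \<le> \<beta> j + j"
  shows "flagged_column \<alpha> \<beta> x k i m = elementary_sym (int k) x {l+1..<m}"
  using assms
proof (induction k arbitrary: i m)
  case 0
  then show ?case by (simp add: elementary_sym_0)
next
  case (Suc k)
  have a: "l \<le> \<alpha> (i+1)" "\<alpha> (i+1) \<le> l + k" "m \<le> \<beta> (i+1) + 1"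
    using Suc.prems[of "i+1"] by auto
  have "flagged_column \<alpha> \<beta> x (Suc k) i m
      = (\<Sum>t\<in>{\<alpha> (i+1) + 1..<m}. x t * elementary_sym (int k) x {l+1..<t})"
    unfolding flagged_column.simps
  proof (rule sum.cong)
    fix t assume t: "t \<in> {\<alpha> (i+1) + 1..<m}"
    have "flagged_column \<alpha> \<beta> x k (i+1) t = elementary_sym (int k) x {l+1..<t}"
    proof (rule Suc.IH)
      fix j assume "i + 1 < j" "j \<le> i + 1 + k"
      then show "l \<le> \<alpha> j \<and> \<alpha> j + j \<le> l + (i + 1 + k) \<and> t + (i + 1) \<le> \<beta> j + j"
        using Suc.prems[of j] t by auto
    qed
    then show "x t * flagged_column \<alpha> \<beta> x k (i+1) t = x t * elementary_sym (int k) x {l+1..<t}"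
      by simp
  qed (use a in auto)
  \<comment> \<open>The added \<open>t\<close> satisfy
    \<open>t \<le> \<alpha> (i+1) \<le> l + k\<close>, so \<open>{l+1..<t}\<close> has fewer than
    \<open>k\<close> elements.\<close>
  also have "\<dots> = (\<Sum>t\<in>{l+1..<m}. x t * elementary_sym (int k) x {l+1..<t})"
  proof (rule sum.mono_neutral_left)
    show "\<forall>t\<in>{l+1..<m} - {\<alpha> (i+1) + 1..<m}. x t * elementary_sym (int k) x {l+1..<t} = 0"
    proof
      fix t assume "t \<in> {l+1..<m} - {\<alpha> (i+1) + 1..<m}"
      then show "x t * elementary_sym (int k) x {l+1..<t} = 0"
        using a by (subst elementary_sym_eq_0) auto
    qed
  qed (use a in auto)
  also have "\<dots> = elementary_sym (int (Suc k)) x {l+1..<m}"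
    using elementary_sym_split_max[of "int (Suc k)" x l m] by simp
  finally show ?case .
qed

text \<open>Above \<open>\<beta> (i+1)\<close> the cutoff excludes nothing, so one uniform cutoff
  can serve all \<open>i\<close>.\<close>

lemma flagged_column_cutoff:
  assumes "0 < k" "\<beta> (i+1) < m" "\<beta> (i+1) < m'"
  shows "flagged_column \<alpha> \<beta> x k i m = flagged_column \<alpha> \<beta> x k i m'"
proof -
  obtain k' where k: "k = Suc k'" using assms(1) gr0_implies_Suc by blast
  have "{t. \<alpha> (i+1) < t \<and> t \<le> \<beta> (i+1) \<and> t < m} = {t. \<alpha> (i+1) < t \<and> t \<le> \<beta> (i+1) \<and> t < m'}"
    using assms by auto
  then show ?thesis unfolding k by (simp only: flagged_column.simps)
qed

text \<open>In a pair of a filling and a multiset, either the top entry of the filling is at least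
  the maximum of the multiset, or the maximum is larger than the top entry. The two sums on the
  right collect these cases, each indexed by the larger of the two numbers.\<close>

lemma complete_sym_mult_flagged_column:
  assumes "d = 0 \<Longrightarrow> \<alpha> (b+1) = l" "d \<noteq> 0 \<Longrightarrow> \<alpha> (b+1) \<le> l" "d \<noteq> 0 \<Longrightarrow> \<beta> (b+1) \<le> u"
    and "\<beta> (b+1) < L"
  shows "complete_sym d x {l+1..u} * flagged_column \<alpha> \<beta> x (Suc k) b L
    = (\<Sum>t\<in>{l+1..\<beta> (b+1)}. x t * complete_sym d x {l+1..t} * flagged_column \<alpha> \<beta> x k (b+1) t)
    + (\<Sum>m\<in>{l+1..u}. x m * complete_sym (d - 1) x {l+1..m} * flagged_column \<alpha> \<beta> x (Suc k) b m)"
proof -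
  let ?F = "flagged_column \<alpha> \<beta> x" and ?h = "\<lambda>d m. complete_sym d x {l+1..m}"
  let ?I = "{\<alpha> (b+1) + 1..\<beta> (b+1)}"
  have I: "{t. \<alpha> (b+1) < t \<and> t \<le> \<beta> (b+1) \<and> t < m} = {t\<in>?I. t < m}" for m
    by auto
  have IL: "{t\<in>?I. t < L} = ?I" using assms(4) by auto
  show ?thesis
  proof (cases "d = 0")
    case True
    \<comment> \<open>In degree 0 the complete polynomial is 1, and the second sum vanishes because
      its degree is -1.\<close>
    then have "{t. \<alpha> (b+1) < t \<and> t \<le> \<beta> (b+1) \<and> t < L} = {l+1..\<beta> (b+1)}"
      using assms(1,4) by auto
    with True show ?thesis
      by (simp only: flagged_column.simps) (simp add: complete_sym_neg)
  next
    case False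
    have "?h d u * ?F (Suc k) b L = (\<Sum>t\<in>?I. x t * ?h d u * ?F k (b+1) t)"
      by (simp only: flagged_column.simps I IL sum_distrib_left) (simp add: mult_ac)
    \<comment> \<open>For a fixed top entry \<open>t\<close>, multisets are split by whether their
      maximum exceeds \<open>t\<close>; afterwards the sums over \<open>t\<close> and
      \<open>m\<close> are exchanged.\<close>
    also have "\<dots> = (\<Sum>t\<in>?I. x t * ?h d t * ?F k (b+1) t
        + (\<Sum>m\<in>{m\<in>{l+1..u}. t < m}. x m * ?h (d - 1) m * (x t * ?F k (b+1) t)))"
    proof (rule sum.cong)
      fix t assume "t \<in> ?I"
      then have "t \<le> u" using assms(3)[OF False] by auto
      have "{max l t + 1..u} = {m\<in>{l+1..u}. t < m}" by auto
      then show "x t * ?h d u * ?F k (b+1) t = x t * ?h d t * ?F k (b+1) t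
          + (\<Sum>m\<in>{m\<in>{l+1..u}. t < m}. x m * ?h (d - 1) m * (x t * ?F k (b+1) t))"
        unfolding complete_sym_split_max[OF \<open>t \<le> u\<close> False]
        by (simp add: algebra_simps sum_distrib_left sum_distrib_right)
    qed simp
    also have "\<dots> = (\<Sum>t\<in>?I. x t * ?h d t * ?F k (b+1) t)
        + (\<Sum>m\<in>{l+1..u}. \<Sum>t\<in>{t\<in>?I. t < m}. x m * ?h (d - 1) m * (x t * ?F k (b+1) t))"
      unfolding sum.distrib by (subst sum.swap_restrict) auto
    also have "(\<Sum>m\<in>{l+1..u}. \<Sum>t\<in>{t\<in>?I. t < m}. x m * ?h (d - 1) m * (x t * ?F k (b+1) t))
        = (\<Sum>m\<in>{l+1..u}. x m * ?h (d - 1) m * ?F (Suc k) b m)"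
      by (simp only: flagged_column.simps I sum_distrib_left)
    \<comment> \<open>For \<open>t \<le> l\<close> the interval \<open>{l+1..t}\<close> is empty and
      \<open>d \<noteq> 0\<close>.\<close>
    also have "(\<Sum>t\<in>?I. x t * ?h d t * ?F k (b+1) t)
        = (\<Sum>t\<in>{l+1..\<beta> (b+1)}. x t * ?h d t * ?F k (b+1) t)"
    proof (rule sum.mono_neutral_right)
      show "\<forall>t\<in>?I - {l+1..\<beta> (b+1)}. x t * ?h d t * ?F k (b+1) t = 0"
      proof
        fix t assume "t \<in> ?I - {l+1..\<beta> (b+1)}"
        then have "{l+1..t} = {}" by auto
        then show "x t * ?h d t * ?F k (b+1) t = 0"
          by (simp only: complete_sym_empty[OF False]) simp
      qed
    qed (use assms(2)[OF False] in auto)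
    finally show ?thesis .
  qed
qed

section \<open>Telescoping: the off-diagonal entries of \<open>H\<close> times its inverse\<close>

lemma alternating_sum_telescope:
  fixes Q :: "nat \<Rightarrow> 'a::comm_ring_1"
  assumes "a \<le> c"
  shows "(\<Sum>b\<in>{a..<c}. (-1) ^ b * (Q (Suc b) + Q b)) = (-1) ^ a * Q a - (-1) ^ c * Q c"
  using assms by (induction c rule: dec_induct) (simp_all add: algebra_simps)

text \<open>Flagged analogue of the alternating relation between the \<open>e\<close> and
  \<open>h\<close>: moving the largest number between multiset and filling cancels terms of
  neighbouring \<open>b\<close>.\<close>

lemma alternating_sum_flagged_column:
  assumes \<alpha>: "antimono_on {1..n} \<alpha>" and \<beta>: "antimono_on {1..n} \<beta>"
    and "a < c" "c \<le> n" and L: "\<And>i. i \<in> {1..n} \<Longrightarrow> \<beta> i < L"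
  shows "(\<Sum>b\<in>{a..c}. (-1) ^ b * (complete_sym (int b - int a) x {\<alpha> (a+1) + 1..\<beta> b}
    * flagged_column \<alpha> \<beta> x (c - b) b L)) = 0"
proof -
  let ?l = "\<alpha> (a+1)"
  let ?t = "\<lambda>b. complete_sym (int b - int a) x {?l+1..\<beta> b} * flagged_column \<alpha> \<beta> x (c - b) b L"
  \<comment> \<open>\<open>Q b\<close> collects the pairs whose multiset has a maximum
    \<open>m\<close> above all entries of the filling.\<close>
  define Q where "Q b = (\<Sum>m\<in>{?l+1..\<beta> b}. x m * complete_sym (int b - int a - 1) x {?l+1..m}
    * flagged_column \<alpha> \<beta> x (c - b) b m)" for b
  have step: "?t b = Q (Suc b) + Q b" if b: "a \<le> b" "b < c" for b
  proof -
    have "c - b = Suc (c - Suc b)" using b by simp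
    moreover have "\<alpha> (b+1) \<le> ?l"
      using \<alpha> assms b by (auto simp: monotone_on_def)
    \<comment> \<open>\<open>a < b\<close> ensures \<open>b \<ge> 1\<close>, since
      \<open>\<beta> 0\<close> is arbitrary; for \<open>b = a\<close> the degree is 0.\<close>
    moreover have "\<beta> (b+1) \<le> \<beta> b" if "a < b"
      using \<beta> assms b that by (auto simp: monotone_on_def)
    ultimately show ?thesis
      using complete_sym_mult_flagged_column[of "int b - int a" \<alpha> b ?l \<beta> "\<beta> b" L x "c - Suc b"]
        L[of "b+1"] b assms
      unfolding Q_def by (cases "a = b") auto
  qed
  have "Q a = 0" by (simp add: Q_def complete_sym_neg)
  \<comment> \<open>For \<open>b = c\<close> the filling is empty. Splitting at 0 sorts all
    multisets by their maximum, as \<open>{?l+1..0}\<close> is empty and the degree is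
    positive.\<close>
  moreover have "?t c = Q c"
    using complete_sym_split_max[of 0 "\<beta> c" "int c - int a" x ?l] \<open>a < c\<close>
    by (simp add: Q_def complete_sym_empty)
  moreover have "{a..c} = insert c {a..<c}" using \<open>a < c\<close> by auto
  moreover have "(\<Sum>b\<in>{a..<c}. (-1) ^ b * ?t b) = (\<Sum>b\<in>{a..<c}. (-1) ^ b * (Q (Suc b) + Q b))"
    by (rule sum.cong) (auto simp only: atLeastLessThan_iff step)
  ultimately show ?thesis
    using alternating_sum_telescope[of a c Q] \<open>a < c\<close> by simp
qed

section \<open>From the inverse matrix to the equality of the two minors\<close>

theorem theorem2p9:
  fixes n :: nat and A B :: "nat set" and \<alpha> \<beta> :: "nat \<Rightarrow> nat"
    and x :: "nat \<Rightarrow> 'a::comm_ring_1"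
  assumes "A \<subseteq> {0..n}" and "B \<subseteq> {0..n}" and "card A = card B"
    and "partition_with_parts n \<alpha>" and "partition_with_parts n \<beta>"
    and "\<forall>i\<in>{1..n}. \<alpha> i \<le> \<beta> i"
    and "\<forall>a' \<in> {0..n} - A. \<forall>b' \<in> {0..n} - B.
           int a' - int b' \<le> 0
         \<or> int a' - int b' > int (\<beta> (b' + 1)) - int (\<alpha> a')
         \<or> (\<forall>i. b' + 1 \<le> i \<and> i \<le> a' \<longrightarrow>
               int (\<alpha> i) - int (\<alpha> a') \<le> int a' - int i
             \<and> int (\<beta> (b' + 1)) - int (\<beta> i) \<le> int i - int b' - 1)"
  shows "det (indexed_mat n A B
            (\<lambda>a b. complete_sym (int b - int a) x {\<alpha> (a + 1) + 1..\<beta> b}))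
       = det (indexed_mat n ({0..n} - A) ({0..n} - B)
            (\<lambda>a' b'. elementary_sym (int a' - int b') x {\<alpha> a' + 1..\<beta> (b' + 1)}))"
proof -
  let ?C = "{0..n} - A" and ?D = "{0..n} - B" and ?N = "n + 1"
  define h where "h a b = complete_sym (int b - int a) x {\<alpha> (a + 1) + 1..\<beta> b}" for a b
  define e where "e a' b' = elementary_sym (int a' - int b') x {\<alpha> a' + 1..\<beta> (b' + 1)}" for a' b'
  \<comment> \<open>Exceeds every \<open>\<beta> i\<close> with \<open>i\<close> in
    \<open>{1..n}\<close>, so as a cutoff it excludes no filling.\<close>
  define L where "L = \<beta> 1 + 1"
  define F where "F b c = (if b \<le> c then flagged_column \<alpha> \<beta> x (c - b) b L else 0)" for b c
  have \<alpha>: "antimono_on {1..n} \<alpha>" and \<beta>: "antimono_on {1..n} \<beta>"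
    using assms(4,5) by (simp_all add: partition_with_parts_def)
  have L: "\<beta> i < L" if "i \<in> {1..n}" for i
    using \<beta> that by (auto simp: monotone_on_def L_def less_Suc_eq_le)
  have h_0: "h a b = 0" if "b < a" for a b using that by (simp add: h_def complete_sym_neg)
  have h_1: "h a a = 1" for a by (simp add: h_def)

  let ?H = "mat ?N ?N (\<lambda>(a, b). h a b)" and ?G = "mat ?N ?N (\<lambda>(b, c). (-1) ^ (b + c) * F b c)"
  have "?H * ?G = 1\<^sub>m ?N"
  proof (rule eq_matI)
    fix a c assume "a < dim_row (1\<^sub>m ?N :: 'a mat)" "c < dim_col (1\<^sub>m ?N :: 'a mat)"
    then have ac: "a \<le> n" "c \<le> n" by auto
    then have "(?H * ?G) $$ (a, c) = (\<Sum>b\<in>{0..n}. h a b * ((-1) ^ (b + c) * F b c))"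
      by (simp add: scalar_prod_def atLeastLessThanSuc_atLeastAtMost del: sum.atLeast0_atMost_Suc sum.op_ivl_Suc)
    \<comment> \<open>\<open>h\<close> vanishes for \<open>b < a\<close> and \<open>F\<close> for
      \<open>b > c\<close>.\<close>
    also have "\<dots> = (\<Sum>b\<in>{a..c}. h a b * ((-1) ^ (b + c) * F b c))"
      by (rule sum.mono_neutral_right) (use ac in \<open>auto simp: F_def h_0\<close>)
    also have "\<dots> = (-1) ^ c * (\<Sum>b\<in>{a..c}. (-1) ^ b * (h a b * flagged_column \<alpha> \<beta> x (c - b) b L))"
      unfolding sum_distrib_left by (rule sum.cong) (simp_all add: F_def power_add mult_ac)
    also have "\<dots> = (if a = c then 1 else 0)"
    proof (cases a c rule: linorder_cases)
      case less
      then show ?thesis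
        using alternating_sum_flagged_column[OF \<alpha> \<beta> less \<open>c \<le> n\<close> L, of x] by (simp add: h_def)
    next
      case equal
      then show ?thesis by (simp add: h_1 flip: power_add)
    qed simp
    finally show "(?H * ?G) $$ (a, c) = 1\<^sub>m ?N $$ (a, c)" using ac by simp
  qed simp_all
  moreover have "det ?H = 1"
  proof -
    have "upper_triangular ?H" by (auto simp: upper_triangular_def h_0)
    then have "det ?H = prod_list (diag_mat ?H)" by (rule det_upper_triangular) auto
    also have "\<dots> = 1" by (simp add: prod_list_diag_prod h_1 del: prod.op_ivl_Suc)
    finally show ?thesis .
  qed
  moreover have set: "{..<?N} = {0..n}" by auto
  ultimately have "det (submatrix ?G ?D ?C) = (-1) ^ (\<Sum>?C + \<Sum>?D) * det (submatrix ?H A B)"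
    using det_submatrix_complementary[of ?H ?N ?G A B] assms(1-3) by simp
  moreover have card: "card ?C = card ?D"
    using assms(1-3) by (simp add: card_Diff_subset finite_subset[of _ "{0..n}"])
  \<comment> \<open>The checkerboard signs of \<open>?G\<close> amount to the very sign in Jacobi's
    identity, so the two cancel.\<close>
  moreover have "det (submatrix ?G ?D ?C)
      = (-1) ^ (\<Sum>?D + \<Sum>?C) * det (submatrix (mat ?N ?N (\<lambda>(b, c). F b c)) ?D ?C)"
    by (rule det_submatrix_checkerboard) (auto simp: card)
  ultimately have *: "det (submatrix ?H A B) = det (submatrix (mat ?N ?N (\<lambda>(b, c). F b c)) ?D ?C)"
    by (simp add: add.commute minus_one_power_iff split: if_splits)

  \<comment> \<open>The three alternatives enter entry by entry. Alternative (i) is the case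
    \<open>\<not> b < c\<close>, where both sides are 1 for \<open>b = c\<close> and 0
    otherwise.\<close>
  have F_eq: "F b c = e c b" if c: "c \<in> ?C" and b: "b \<in> ?D" for b c
  proof (cases "b < c")
    case False
    then show ?thesis
      by (cases "b = c") (simp_all add: F_def e_def elementary_sym_0 elementary_sym_neg)
  next
    case True
    have mono: "\<alpha> c \<le> \<alpha> j" if "b < j" "j \<le> c" for j
      using \<alpha> c that by (auto simp: monotone_on_def)
    have "F b c = flagged_column \<alpha> \<beta> x (c - b) b L" using True by (simp add: F_def)
    also have "\<dots> = flagged_column \<alpha> \<beta> x (c - b) b (\<beta> (b+1) + 1)"
      using True c by (intro flagged_column_cutoff L) auto
    also have "\<dots> = e c b"
    proof (cases "int c - int b > int (\<beta> (b + 1)) - int (\<alpha> c)")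
      case True
      \<comment> \<open>Alternative (ii): fewer than \<open>c - b\<close> numbers lie in
        \<open>{\<alpha> c + 1..\<beta> (b+1)}\<close>, so both sides vanish.\<close>
      have "flagged_column \<alpha> \<beta> x (c - b) b (\<beta> (b+1) + 1) = 0"
        by (rule flagged_column_eq_0[of _ _ "\<alpha> c"]) (use True \<open>b < c\<close> mono in auto)
      moreover have "e c b = 0"
        unfolding e_def by (rule elementary_sym_eq_0) (use True \<open>b < c\<close> in auto)
      ultimately show ?thesis by simp
    next
      case False
      moreover have "\<not> int c - int b \<le> 0" using \<open>b < c\<close> by simp
      ultimately have bounds: "\<forall>i. b + 1 \<le> i \<and> i \<le> c \<longrightarrow>
          int (\<alpha> i) - int (\<alpha> c) \<le> int c - int i
        \<and> int (\<beta> (b + 1)) - int (\<beta> i) \<le> int i - int b - 1"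
        using assms(7)[THEN bspec, OF c, THEN bspec, OF b] by (elim disjE) (blast | assumption)+
      \<comment> \<open>Alternative (iii) and the monotonicity of \<open>\<alpha>\<close> give the
        required bounds with \<open>l = \<alpha> c\<close> and
        \<open>m = \<beta> (b+1) + 1\<close>.\<close>
      have "flagged_column \<alpha> \<beta> x (c - b) b (\<beta> (b+1) + 1)
          = elementary_sym (int (c - b)) x {\<alpha> c + 1..<\<beta> (b+1) + 1}"
      proof (rule flagged_column_eq_elementary_sym)
        fix j assume "b < j" "j \<le> b + (c - b)"
        then show "\<alpha> c \<le> \<alpha> j \<and> \<alpha> j + j \<le> \<alpha> c + (b + (c - b)) \<and> \<beta> (b+1) + 1 + b \<le> \<beta> j + j"
          using True mono[of j] bounds[rule_format, of j] by linarith
      qed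
      also have "\<dots> = e c b"
        using True by (simp add: e_def of_nat_diff atLeastLessThanSuc_atLeastAtMost)
      finally show ?thesis .
    qed
    finally show ?thesis .
  qed
  let ?E = "mat ?N ?N (\<lambda>(a', b'). e a' b')"
  have sub: "?C \<subseteq> {..<?N}" "?D \<subseteq> {..<?N}" by auto
  have pC: "pick ?C i \<in> ?C" if "i < card ?C" for i using pick_in_set_le[OF that] .
  have pD: "pick ?D i \<in> ?D" if "i < card ?D" for i using pick_in_set_le[OF that] .
  have "submatrix (mat ?N ?N (\<lambda>(b, c). F b c)) ?D ?C
      = mat (card ?D) (card ?C) (\<lambda>(i, j). F (pick ?D i) (pick ?C j))"
    by (rule submatrix_mat[OF sub(2,1)])
  \<comment> \<open>The minor of \<open>F\<close> has its rows in \<open>?D\<close>, that of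
    \<open>e\<close> in \<open>?C\<close>; transposition preserves the determinant.\<close>
  also have "\<dots> = transpose_mat (mat (card ?C) (card ?D) (\<lambda>(i, j). e (pick ?C i) (pick ?D j)))"
    using F_eq pC pD by (intro eq_matI) simp_all
  also have "mat (card ?C) (card ?D) (\<lambda>(i, j). e (pick ?C i) (pick ?D j)) = submatrix ?E ?C ?D"
    by (rule submatrix_mat[OF sub, symmetric])
  finally have "det (submatrix (mat ?N ?N (\<lambda>(b, c). F b c)) ?D ?C) = det (submatrix ?E ?C ?D)"
    using submatrix_mat[OF sub, of e] card by (simp only: det_transpose[OF mat_carrier])
  with * show ?thesis
    by (simp only: indexed_mat_def h_def e_def)
qed

end
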